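(* The set $$A=\left\{ \alpha f_{5n} \mid n\in \mathbb{N},\ \alpha \in \mathbb{Z}\right\}\subseteq \mathbb{Z}$$ is, with the usual addition and multiplication of integers, a commutative non-unitary ring (that is, a commutative ring without multiplicative identity element).
   Context: $(f_n)_{n\ge 0}$ is the Fibonacci sequence: $f_0=0$, $f_1=1$, $f_n=f_{n-1}+f_{n-2}$ for $n\ge 2$. Here $\mathbb{N}$ includes $0$. *)

theory Defs
  imports "HOL-Number_Theory.Fib" "HOL-Algebra.IntRing"
begin

text \<open>
  The locale \<^locale>\<open>ring\<close> of HOL-Algebra includes a multiplicative identity. The following
  locale has the same axioms except that the multiplication is only a semigroup operation.
  It reuses the record type of rings, but none of its axioms mentions the field \<open>one\<close>.
\<close>

locale nonunital_ring = abelian_group R for R (structure) +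
  assumes rng_m_closed: "\<lbrakk> x \<in> carrier R; y \<in> carrier R \<rbrakk> \<Longrightarrow> x \<otimes> y \<in> carrier R"
    and rng_m_assoc: "\<lbrakk> x \<in> carrier R; y \<in> carrier R; z \<in> carrier R \<rbrakk>
      \<Longrightarrow> (x \<otimes> y) \<otimes> z = x \<otimes> (y \<otimes> z)"
    and rng_l_distr: "\<lbrakk> x \<in> carrier R; y \<in> carrier R; z \<in> carrier R \<rbrakk>
      \<Longrightarrow> (x \<oplus> y) \<otimes> z = x \<otimes> z \<oplus> y \<otimes> z"
    and rng_r_distr: "\<lbrakk> x \<in> carrier R; y \<in> carrier R; z \<in> carrier R \<rbrakk>
      \<Longrightarrow> z \<otimes> (x \<oplus> y) = z \<otimes> x \<oplus> z \<otimes> y"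

locale nonunital_cring = nonunital_ring R for R (structure) +
  assumes rng_m_comm: "\<lbrakk> x \<in> carrier R; y \<in> carrier R \<rbrakk> \<Longrightarrow> x \<otimes> y = y \<otimes> x"

definition has_mult_identity :: "('a, 'm) ring_scheme \<Rightarrow> bool" where
  "has_mult_identity R \<longleftrightarrow>
    (\<exists>e \<in> carrier R. \<forall>x \<in> carrier R. e \<otimes>\<^bsub>R\<^esub> x = x \<and> x \<otimes>\<^bsub>R\<^esub> e = x)"

definition fib5_multiples :: "int set" where
  "fib5_multiples = {\<alpha> * int (fib (5 * n)) | (n :: nat) (\<alpha> :: int). True}"

text \<open>
  The integers with their usual operations, restricted to \<^const>\<open>fib5_multiples\<close>. The field
  \<open>one\<close> is inherited from the integers and is not claimed to lie in the carrier.
\<close>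

definition fib5_ring :: "int ring" where
  "fib5_ring = \<Z>\<lparr>carrier := fib5_multiples\<rparr>"

end

theory Submission
  imports Defs
begin

text \<open>
  The set is the ideal \<open>5\<int>\<close>. On the one hand \<open>f\<^sub>5 = 5\<close>, so the multiples of \<open>f\<^sub>5\<close> alone already
  exhaust \<open>5\<int>\<close>; on the other hand \<open>n \<mapsto> f\<^sub>n\<close> preserves divisibility, so every \<open>f\<^bsub>5n\<^esub>\<close> lies in \<open>5\<int>\<close>.
  An ideal is closed under sums, negatives and products, and inherits the remaining ring laws from
  \<open>\<int>\<close>. An identity \<open>e\<close> would satisfy \<open>5e = 5\<close>, which forces \<open>e = 1 \<notin> 5\<int>\<close>.
\<close>

text \<open>
  When \<open>m\<close> divides \<open>n\<close>, \<open>gcd m n = m\<close>, so the identity \<open>fib (gcd m n) = gcd (fib m) (fib n)\<close> exhibits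
  \<open>fib m\<close> as a common divisor.
\<close>

lemma fib_dvd_fib:
  assumes "m dvd n"
  shows "fib m dvd fib n"
  using assms by (metis fib_gcd gcd_dvd2 gcd_nat.absorb1)

lemma fib_5: "fib 5 = 5"
  by (simp add: numeral_eq_Suc)

lemma fib5_multiples_eq: "fib5_multiples = {x. 5 dvd x}"
proof (intro equalityI subsetI)
  fix x
  assume "x \<in> fib5_multiples"
  then obtain \<alpha> n where x: "x = \<alpha> * int (fib (5 * n))"
    by (auto simp: fib5_multiples_def)
  have "5 dvd fib (5 * n)"
    using fib_dvd_fib[of 5 "5 * n"] by (simp add: fib_5)
  then have "int 5 dvd int (fib (5 * n))"
    by (simp only: int_dvd_int_iff)
  then show "x \<in> {x. 5 dvd x}"
    by (simp add: x)
next
  fix x :: int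
  assume "x \<in> {x. 5 dvd x}"
  then obtain \<alpha> where "x = \<alpha> * int (fib (5 * 1))"
    by (auto simp: fib_5 mult.commute elim!: dvdE)
  then show "x \<in> fib5_multiples"
    unfolding fib5_multiples_def by blast
qed

lemma fib5_ring_simps:
  "carrier fib5_ring = {x. 5 dvd x}"
  "x \<otimes>\<^bsub>fib5_ring\<^esub> y = x * y"
  "x \<oplus>\<^bsub>fib5_ring\<^esub> y = x + y"
  "\<zero>\<^bsub>fib5_ring\<^esub> = 0"
  by (simp_all add: fib5_ring_def fib5_multiples_eq)

lemma nonunital_cring_fib5_ring: "nonunital_cring fib5_ring"
proof -
  interpret abelian_group fib5_ring
  proof (rule abelian_groupI)
    fix x
    assume "x \<in> carrier fib5_ring"
    then show "\<exists>y\<in>carrier fib5_ring. y \<oplus>\<^bsub>fib5_ring\<^esub> x = \<zero>\<^bsub>fib5_ring\<^esub>"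
      by (intro bexI[of _ "- x"]) (simp_all add: fib5_ring_simps)
  qed (simp_all add: fib5_ring_simps)
  show ?thesis
    by unfold_locales (simp_all add: fib5_ring_simps algebra_simps)
qed

lemma no_mult_identity_fib5_ring: "\<not> has_mult_identity fib5_ring"
proof
  assume "has_mult_identity fib5_ring"
  then obtain e :: int where e: "5 dvd e" and id: "\<And>x. 5 dvd x \<Longrightarrow> e * x = x"
    by (auto simp: has_mult_identity_def fib5_ring_simps)
  have "e = 1"
    using id[of 5] by simp
  with e show False
    by simp
qed

theorem proposition3p2:
  shows "nonunital_cring fib5_ring \<and> \<not> has_mult_identity fib5_ring"
  using nonunital_cring_fib5_ring no_mult_identity_fib5_ring by simp

end
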